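(* Let $f:\mathbb{R}^n\to\mathbb{R}$ be convex and twice differentiable, let $x_k\in\mathbb{R}^n$, $g_k=\nabla f(x_k)\neq 0$, $H_k=\nabla^2f(x_k)$. For any $\gamma_k>0$, there is a choice of $\delta_k\in\mathbb{R}$ such that the solution $[v_k;t_k]$ of the generalized homogeneous model $$\min_{\|[v;t]\|\le 1}\ [v;t]^T\begin{bmatrix}H_k & g_k\\ g_k^T & \delta_k\end{bmatrix}[v;t]$$ satisfies $t_k\neq0$ and generates, via $x_{k+1}=x_k+v_k/t_k$, the same iterate as the gradient-regularized Newton step $$x_{k+1}=x_k-\left(H_k+\gamma_k\|g_k\|^{1/2}I\right)^{-1}g_k .$$ Furthermore, the number of inner iterations $\mathcal{T}_k$ (the number of generalized homogeneous models solved) for finding the desired $\delta_k$ is bounded by $O(\log(\epsilon^{-1}))$ using a bisection method, or by $O(\log\log(\epsilon^{-1}))$ with Newton's method.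
   Context: $v\in\mathbb{R}^n$, $t\in\mathbb{R}$, and $\|\cdot\|$ is the Euclidean norm. A multiplier $\theta_k\ge0$ is associated with the homogeneous model: writing $F_k$ for its matrix, $F_k+\theta_kI\succeq0$, $(F_k+\theta_kI)[v_k;t_k]=0$, $\theta_k(\|[v_k;t_k]\|-1)=0$. The search is for $\delta_k$ such that $\theta_k=\theta_k(\delta_k)=\gamma_k\|g_k\|^{1/2}$; bisection and Newton's method are applied to this one-dimensional equation in $\delta_k$, each evaluation of $\theta_k(\delta_k)$ costing one homogeneous model. $\epsilon>0$ is the prescribed accuracy of the search, and implied constants may depend on $H_k,g_k,\gamma_k$ but not on $\epsilon$. *)

theory Defs
  imports "HOL-Analysis.Analysis" "HOL-Library.Landau_Symbols"
begin

text \<open>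
  Vectors of dimension \<open>n + 1\<close> are indexed by \<open>'n option\<close>: the indices \<open>Some i\<close> carry the
  upper block and \<open>None\<close> carries the last component.
\<close>

definition stack :: "real ^ 'n \<Rightarrow> real \<Rightarrow> real ^ ('n option)" where
  "stack v t = (\<chi> i. case i of Some a \<Rightarrow> v $ a | None \<Rightarrow> t)"

definition hom_matrix ::
  "real ^ 'n ^ 'n \<Rightarrow> real ^ 'n \<Rightarrow> real \<Rightarrow> real ^ ('n option) ^ ('n option)" where
  "hom_matrix H g \<delta> = (\<chi> i j.
     case i of
       Some a \<Rightarrow> (case j of Some b \<Rightarrow> H $ a $ b | None \<Rightarrow> g $ a)
     | None \<Rightarrow> (case j of Some b \<Rightarrow> g $ b | None \<Rightarrow> \<delta>))"

definition psd :: "real ^ 'm ^ 'm \<Rightarrow> bool" where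
  "psd A \<longleftrightarrow> transpose A = A \<and> (\<forall>x. 0 \<le> x \<bullet> (A *v x))"

definition hom_solution ::
  "real ^ 'n ^ 'n \<Rightarrow> real ^ 'n \<Rightarrow> real \<Rightarrow> real ^ 'n \<Rightarrow> real \<Rightarrow> bool" where
  "hom_solution H g \<delta> v t \<longleftrightarrow>
     is_arg_min (\<lambda>w. w \<bullet> (hom_matrix H g \<delta> *v w)) (\<lambda>w. norm w \<le> 1) (stack v t)"

definition is_multiplier ::
  "real ^ 'n ^ 'n \<Rightarrow> real ^ 'n \<Rightarrow> real \<Rightarrow> real ^ 'n \<Rightarrow> real \<Rightarrow> real \<Rightarrow> bool" where
  "is_multiplier H g \<delta> v t \<theta> \<longleftrightarrow>
     0 \<le> \<theta> \<and>
     psd (hom_matrix H g \<delta> + \<theta> *\<^sub>R mat 1) \<and>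
     (hom_matrix H g \<delta> + \<theta> *\<^sub>R mat 1) *v stack v t = 0 \<and>
     \<theta> * (norm (stack v t) - 1) = 0"

text \<open>
  The solution of the model is never unique (if \<open>w\<close> is a solution, so is \<open>- w\<close>), but for
  symmetric \<open>H\<close> all solutions share one multiplier, so it is a function of \<open>\<delta>\<close>.
\<close>

definition hom_multiplier :: "real ^ 'n ^ 'n \<Rightarrow> real ^ 'n \<Rightarrow> real \<Rightarrow> real" where
  "hom_multiplier H g \<delta> =
     (THE \<theta>. \<exists>v t. hom_solution H g \<delta> v t \<and> is_multiplier H g \<delta> v t \<theta>)"

text \<open>
  One-dimensional search for \<open>\<theta> \<delta> = c\<close>, where \<open>\<theta>\<close> is nonincreasing. Both methods produce a
  sequence of trial values of \<open>\<delta>\<close>, and each trial value costs one evaluation of \<open>\<theta>\<close>.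
\<close>

definition brackets :: "(real \<Rightarrow> real) \<Rightarrow> real \<Rightarrow> real \<Rightarrow> real \<Rightarrow> bool" where
  "brackets \<theta> c l u \<longleftrightarrow> l < u \<and> \<theta> u \<le> c \<and> c \<le> \<theta> l"

definition bisection_step :: "(real \<Rightarrow> real) \<Rightarrow> real \<Rightarrow> real \<times> real \<Rightarrow> real \<times> real" where
  "bisection_step \<theta> c = (\<lambda>(l, u). let m = (l + u) / 2 in if c < \<theta> m then (m, u) else (l, m))"

definition bisection_iterates :: "(real \<Rightarrow> real) \<Rightarrow> real \<Rightarrow> real \<Rightarrow> real \<Rightarrow> nat \<Rightarrow> real" where
  "bisection_iterates \<theta> c l u j =
     (let (l', u') = (bisection_step \<theta> c ^^ j) (l, u) in (l' + u') / 2)"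

text \<open>
  The derivative costs no further evaluation: if \<open>[v; t]\<close> solves the model and the
  multiplier is positive, then the derivative of the multiplier with respect to \<open>\<delta>\<close> is \<open>- t\<^sup>2\<close>.
\<close>

definition newton_iterates :: "(real \<Rightarrow> real) \<Rightarrow> real \<Rightarrow> (nat \<Rightarrow> real) \<Rightarrow> bool" where
  "newton_iterates \<theta> c \<delta>s \<longleftrightarrow>
     (\<forall>j. \<exists>D. (\<theta> has_real_derivative D) (at (\<delta>s j)) \<and> D \<noteq> 0 \<and>
          \<delta>s (Suc j) = \<delta>s j - (\<theta> (\<delta>s j) - c) / D)"

text \<open>
  Accuracy is demanded both of the parameter and of the residual of the equation; \<open>d\<close> is the
  exact root.
\<close>

definition accurate :: "(real \<Rightarrow> real) \<Rightarrow> real \<Rightarrow> real \<Rightarrow> real \<Rightarrow> bool" where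
  "accurate \<theta> d \<epsilon> \<delta> \<longleftrightarrow> \<bar>\<delta> - d\<bar> \<le> \<epsilon> \<and> \<bar>\<theta> \<delta> - \<theta> d\<bar> \<le> \<epsilon>"

text \<open>
  Number of evaluations of \<open>\<theta>\<close>, at \<open>\<delta>s 0, \<dots>, \<delta>s T\<close>, where \<open>T\<close> is the first index from which on all
  trial values are accurate. It bounds the number of evaluations up to the first accurate
  trial value. It is meaningful only if such a \<open>T\<close> exists, which is always
  asserted separately.
\<close>

definition inner_iterations :: "(real \<Rightarrow> real) \<Rightarrow> real \<Rightarrow> (nat \<Rightarrow> real) \<Rightarrow> real \<Rightarrow> nat" where
  "inner_iterations \<theta> d \<delta>s \<epsilon> = Suc (LEAST T. \<forall>j\<ge>T. accurate \<theta> d \<epsilon> (\<delta>s j))"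

end

theory Submission
  imports Defs "HOL-Real_Asymp.Real_Asymp"
begin

text \<open>
  Write \<open>M \<delta>\<close> for the homogeneous matrix and \<open>q \<delta> w = w \<bullet> (M \<delta> *v w)\<close>. A multiplier of a
  minimiser \<open>w\<close> on the unit ball must equal \<open>- q \<delta> w\<close>, so \<open>\<theta> \<delta>\<close> is the maximum of \<open>- q \<delta> w\<close>
  over the ball. For fixed \<open>w = [v; t]\<close> the number \<open>- q \<delta> w\<close> is affine in \<open>\<delta>\<close> with slope
  \<open>- t\<^sup>2\<close>, which lies between \<open>- 1\<close> and \<open>0\<close>. Hence \<open>\<theta>\<close> is convex, nonincreasing and 1-Lipschitz,
  and \<open>- t\<^sup>2\<close> is a subgradient whenever \<open>[v; t]\<close> solves the model.

  Where \<open>\<theta> \<delta> > 0\<close>, the solution has norm 1 and is a null vector of \<open>M \<delta> + \<theta> I\<close>. Its upper block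
  says that \<open>s = - v / t\<close> solves \<open>(H + \<theta> I) s = g\<close>; here \<open>t \<noteq> 0\<close> because \<open>H + \<theta> I\<close> is positive
  definite, the Hessian of a convex function being symmetric and positive semidefinite. So at a
  parameter \<open>d\<close> with \<open>\<theta> d = c\<close> the step \<open>v / t = - s\<close> is the regularized Newton step. Such a \<open>d\<close>
  is explicit: with \<open>(H + c I) s = g\<close> take \<open>d = g \<bullet> s - c\<close>, which makes the Schur complement of
  \<open>H + c I\<close> in \<open>M d + c I\<close> vanish, so that \<open>M d + c I\<close> is singular and positive semidefinite
  (\<open>hom_multiplier_attained\<close>).

  Normalisation gives \<open>t\<^sup>2 = 1 / (1 + \<parallel>s\<parallel>\<^sup>2)\<close>, and \<open>s\<close> depends on \<open>\<theta>\<close> in a Lipschitz way as long as \<open>\<theta>\<close>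
  stays away from 0 (\<open>hom_slope_lipschitz\<close>). The slope is therefore negative and locally
  Lipschitz where \<open>\<theta> > 0\<close>, hence it is the derivative there. The locale \<open>convex_search\<close> collects
  these properties, and the two complexity bounds follow from them alone.
  A bracket contains the root and bisection halves it. Newton's method on a convex decreasing
  function lands at or to the left of the root after one step, then approaches it monotonically: at
  least linearly, with factor \<open>1 + \<theta>' d\<close>, from anywhere to the left, and quadratically because
  of the Lipschitz slope.
\<close>

section \<open>Iteration counts from error bounds\<close>

lemma inner_iterations_le:
  assumes "\<And>j. j \<ge> T \<Longrightarrow> accurate \<theta> d \<epsilon> (\<delta>s j)"
  shows "inner_iterations \<theta> d \<delta>s \<epsilon> \<le> Suc T"
  unfolding inner_iterations_def using assms by (auto intro: Least_le)

text \<open>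
  The error \<open>C / 2\<^sup>j\<close> falls below \<open>\<epsilon>\<close> as soon as \<open>j\<close> reaches the binary logarithm of \<open>C / \<epsilon>\<close>.
\<close>

lemma inner_iterations_geometric:
  assumes C: "C > 0"
    and acc: "\<And>j \<epsilon>. C * (1 / 2) ^ j \<le> \<epsilon> \<Longrightarrow> accurate \<theta> d \<epsilon> (\<delta>s j)"
  shows "(\<lambda>\<epsilon>. real (inner_iterations \<theta> d \<delta>s \<epsilon>)) \<in> O[at_right 0](\<lambda>\<epsilon>. ln (1 / \<epsilon>))"
proof -
  have bound: "real (inner_iterations \<theta> d \<delta>s \<epsilon>) \<le> log 2 (C / \<epsilon>) + 2" if e: "0 < \<epsilon>" "\<epsilon> < C" for \<epsilon>
  proof -
    define T where "T = nat \<lceil>log 2 (C / \<epsilon>)\<rceil>"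
    have pos: "0 < log 2 (C / \<epsilon>)" using e by simp
    have "inner_iterations \<theta> d \<delta>s \<epsilon> \<le> Suc T"
    proof (rule inner_iterations_le, rule acc)
      fix j assume "j \<ge> T"
      then have "log 2 (C / \<epsilon>) \<le> real j" unfolding T_def by linarith
      then have "2 powr (log 2 (C / \<epsilon>)) \<le> 2 powr real j" by simp
      then have "C / \<epsilon> \<le> 2 ^ j" using e C by (simp add: powr_realpow)
      then show "C * (1 / 2) ^ j \<le> \<epsilon>" using e by (simp add: field_simps)
    qed
    then show ?thesis using pos unfolding T_def by linarith
  qed
  have "eventually (\<lambda>\<epsilon>. 0 < \<epsilon> \<and> \<epsilon> < C) (at_right 0)"
    using C by (auto simp: eventually_at_right_field)
  then have "(\<lambda>\<epsilon>. real (inner_iterations \<theta> d \<delta>s \<epsilon>)) \<in> O[at_right 0](\<lambda>\<epsilon>. log 2 (C / \<epsilon>) + 2)"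
    by (intro bigoI[where c = 1], elim eventually_mono) (use bound in fastforce)
  also have "(\<lambda>\<epsilon>. log 2 (C / \<epsilon>) + 2) \<in> O[at_right 0](\<lambda>\<epsilon>. ln (1 / \<epsilon>))"
    using C by real_asymp
  finally show ?thesis .
qed

text \<open>
  The offset \<open>J\<close> leaves room for the iterations spent before the quadratic phase begins, and
  \<open>K\<close> is the constant by which errors are scaled to make squaring exact. Both only add to the
  count or perturb it inside a logarithm.
\<close>

lemma inner_iterations_doubly_exponential:
  assumes K: "K > 0"
    and acc: "\<And>i \<epsilon>. (1 / 2) ^ (2 ^ i) \<le> K * \<epsilon> \<Longrightarrow> accurate \<theta> d \<epsilon> (\<delta>s (J + i))"
  shows "(\<lambda>\<epsilon>. real (inner_iterations \<theta> d \<delta>s \<epsilon>)) \<in> O[at_right 0](\<lambda>\<epsilon>. ln (ln (1 / \<epsilon>)))"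
proof -
  have bound: "real (inner_iterations \<theta> d \<delta>s \<epsilon>) \<le> (real J + 2) + log 2 (log 2 (1 / (K * \<epsilon>)))"
    if e: "0 < \<epsilon>" "\<epsilon> < 1 / (2 * K)" for \<epsilon>
  proof -
    define T where "T = nat \<lceil>log 2 (log 2 (1 / (K * \<epsilon>)))\<rceil>"
    have "0 < K * \<epsilon>" "K * \<epsilon> < 1 / 2" using e K by (simp_all add: field_simps)
    then have "1 / (K * \<epsilon>) > 2" by (simp add: field_simps)
    then have "log 2 (1 / (K * \<epsilon>)) > log 2 2"
      using \<open>0 < K * \<epsilon>\<close> by (subst log_less_cancel_iff) auto
    then have one: "log 2 (1 / (K * \<epsilon>)) > 1" by simp
    then have pos: "0 < log 2 (log 2 (1 / (K * \<epsilon>)))" by simp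
    have "inner_iterations \<theta> d \<delta>s \<epsilon> \<le> Suc (J + T)"
    proof (rule inner_iterations_le)
      fix j assume j: "j \<ge> J + T"
      then obtain i where i: "j = J + i" "i \<ge> T"
        by (metis add_le_cancel_left add_leD1 le_Suc_ex)
      then have "log 2 (log 2 (1 / (K * \<epsilon>))) \<le> real i" unfolding T_def by linarith
      then have "2 powr log 2 (log 2 (1 / (K * \<epsilon>))) \<le> 2 powr real i" by simp
      then have "log 2 (1 / (K * \<epsilon>)) \<le> real (2 ^ i)" using one by (simp add: powr_realpow)
      then have "2 powr log 2 (1 / (K * \<epsilon>)) \<le> 2 powr real (2 ^ i)" by (subst powr_le_cancel_iff) auto
      then have "1 / (K * \<epsilon>) \<le> 2 ^ (2 ^ i)"
        using e K by (subst (asm) powr_realpow) auto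
      then have "(1 / 2) ^ (2 ^ i) \<le> K * \<epsilon>" using e K by (simp add: field_simps)
      then show "accurate \<theta> d \<epsilon> (\<delta>s j)" using acc i by blast
    qed
    then show ?thesis using pos unfolding T_def by linarith
  qed
  have "eventually (\<lambda>\<epsilon>. 0 < \<epsilon> \<and> \<epsilon> < 1 / (2 * K)) (at_right 0)"
    using K by (auto simp: eventually_at_right_field intro!: exI[of _ "1 / (2 * K)"])
  then have "(\<lambda>\<epsilon>. real (inner_iterations \<theta> d \<delta>s \<epsilon>))
      \<in> O[at_right 0](\<lambda>\<epsilon>. (real J + 2) + log 2 (log 2 (1 / (K * \<epsilon>))))"
    by (intro bigoI[where c = 1], elim eventually_mono) (use bound in fastforce)
  also have "(\<lambda>\<epsilon>. (real J + 2) + log 2 (log 2 (1 / (K * \<epsilon>)))) \<in> O[at_right 0](\<lambda>\<epsilon>. ln (ln (1 / \<epsilon>)))"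
    using K by real_asymp
  finally show ?thesis .
qed

section \<open>Root search on a convex decreasing function\<close>

text \<open>
  The Lipschitz bound on the slope \<open>D\<close> is measured in the values of \<open>\<theta>\<close> because the solution of
  a shifted linear system depends on the parameter only through the shift. It degrades like
  \<open>1 / b\<^sup>2\<close> as the lower bound \<open>b\<close> on the values tends to zero, where \<open>\<theta>\<close> may have a kink.
\<close>

locale convex_search =
  fixes \<theta> D :: "real \<Rightarrow> real" and G d :: real
  assumes subgradient: "\<theta> x + D x * (y - x) \<le> \<theta> y"
    and slope_ge: "- 1 \<le> D x"
    and slope_le: "D x \<le> 0"
    and slope_neg: "0 < \<theta> x \<Longrightarrow> D x < 0"
    and slope_lipschitz_value:
      "\<lbrakk>0 < b; b \<le> \<theta> x; b \<le> \<theta> y\<rbrakk> \<Longrightarrow> \<bar>D x - D y\<bar> \<le> G / b\<^sup>2 * \<bar>\<theta> x - \<theta> y\<bar>"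
    and slope_lipschitz_const_nonneg: "0 \<le> G"
    and root_pos: "0 < \<theta> d"
begin

lemma antimono: "x \<le> y \<Longrightarrow> \<theta> y \<le> \<theta> x"
  using subgradient[of y x] slope_le[of y] mult_nonpos_nonpos[of "D y" "x - y"] by simp

lemma lipschitz: "\<bar>\<theta> x - \<theta> y\<bar> \<le> \<bar>x - y\<bar>"
proof -
  have "\<theta> p - \<theta> q \<le> \<bar>p - q\<bar>" for p q
  proof -
    have "\<theta> p - \<theta> q \<le> \<bar>D p * (q - p)\<bar>" using subgradient[of p q] by linarith
    also have "\<dots> \<le> 1 * \<bar>q - p\<bar>"
      unfolding abs_mult using slope_ge[of p] slope_le[of p] by (intro mult_right_mono) auto
    finally show ?thesis by simp
  qed
  from this[of x y] this[of y x] show ?thesis by (simp add: abs_minus_commute abs_le_iff)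
qed

lemma accurateI: "\<bar>\<delta> - d\<bar> \<le> \<epsilon> \<Longrightarrow> accurate \<theta> d \<epsilon> \<delta>"
  unfolding accurate_def using lipschitz[of \<delta> d] by simp

text \<open>
  At the root the slope is strictly negative, so the tangent there separates the values to the
  left from the root value. To the right of the root, \<open>\<theta>\<close> may be constant, namely 0, but this
  happens strictly below \<open>\<theta> d\<close>. Comparing values with \<open>\<theta> d\<close> thus locates the root exactly.
\<close>

lemma less_root_iff: "\<delta> < d \<longleftrightarrow> \<theta> d < \<theta> \<delta>"
proof
  assume "\<delta> < d"
  then have "0 < D d * (\<delta> - d)" using slope_neg[OF root_pos] by (simp add: mult_neg_neg)
  then show "\<theta> d < \<theta> \<delta>" using subgradient[of d \<delta>] by simp
next
  show "\<theta> d < \<theta> \<delta> \<Longrightarrow> \<delta> < d" using antimono[of d \<delta>] by force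
qed

lemma le_root_iff: "\<delta> \<le> d \<longleftrightarrow> \<theta> d \<le> \<theta> \<delta>"
proof
  assume le: "\<theta> d \<le> \<theta> \<delta>"
  show "\<delta> \<le> d"
  proof (rule ccontr)
    assume "\<not> \<delta> \<le> d"
    moreover have "D \<delta> < 0" using le root_pos slope_neg by simp
    ultimately have "0 < D \<delta> * (d - \<delta>)" by (simp add: mult_neg_neg)
    then show False using subgradient[of \<delta> d] le by simp
  qed
qed (rule antimono)

lemma brackets_iff: "brackets \<theta> (\<theta> d) l u \<longleftrightarrow> l < u \<and> l \<le> d \<and> d \<le> u"
  unfolding brackets_def using le_root_iff[of l] less_root_iff[of u] by auto

lemma bisection_bracket:
  assumes "brackets \<theta> (\<theta> d) l u"
  obtains l' u' where "(bisection_step \<theta> (\<theta> d) ^^ j) (l, u) = (l', u')"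
    "brackets \<theta> (\<theta> d) l' u'" "u' - l' = (u - l) * (1 / 2) ^ j"
proof -
  have "\<exists>l' u'. (bisection_step \<theta> (\<theta> d) ^^ j) (l, u) = (l', u') \<and>
      brackets \<theta> (\<theta> d) l' u' \<and> u' - l' = (u - l) * (1 / 2) ^ j"
  proof (induction j)
    case 0
    then show ?case using assms by simp
  next
    case (Suc j)
    then obtain l' u' where *: "(bisection_step \<theta> (\<theta> d) ^^ j) (l, u) = (l', u')"
      "brackets \<theta> (\<theta> d) l' u'" "u' - l' = (u - l) * (1 / 2) ^ j" by blast
    have step: "(bisection_step \<theta> (\<theta> d) ^^ Suc j) (l, u) = bisection_step \<theta> (\<theta> d) (l', u')"
      by (simp add: *(1))
    show ?case
    proof (cases "\<theta> d < \<theta> ((l' + u') / 2)")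
      case True
      then have "bisection_step \<theta> (\<theta> d) (l', u') = ((l' + u') / 2, u')"
        by (simp add: bisection_step_def Let_def)
      moreover have "brackets \<theta> (\<theta> d) ((l' + u') / 2) u'"
        using *(2) True by (auto simp: brackets_def)
      moreover have "u' - (l' + u') / 2 = (u - l) * (1 / 2) ^ Suc j"
        using *(3) by (simp add: field_simps)
      ultimately show ?thesis unfolding step by blast
    next
      case False
      then have "bisection_step \<theta> (\<theta> d) (l', u') = (l', (l' + u') / 2)"
        by (simp add: bisection_step_def Let_def)
      moreover have "brackets \<theta> (\<theta> d) l' ((l' + u') / 2)"
        using *(2) False by (auto simp: brackets_def)
      moreover have "(l' + u') / 2 - l' = (u - l) * (1 / 2) ^ Suc j"
        using *(3) by (simp add: field_simps)
      ultimately show ?thesis unfolding step by blast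
    qed
  qed
  then show ?thesis using that by blast
qed

lemma bisection_error:
  assumes "brackets \<theta> (\<theta> d) l u"
  shows "\<bar>bisection_iterates \<theta> (\<theta> d) l u j - d\<bar> \<le> (u - l) * (1 / 2) ^ j"
proof -
  obtain l' u' where *: "(bisection_step \<theta> (\<theta> d) ^^ j) (l, u) = (l', u')"
    "brackets \<theta> (\<theta> d) l' u'" "u' - l' = (u - l) * (1 / 2) ^ j"
    using bisection_bracket[OF assms] by blast
  have "\<bar>(l' + u') / 2 - d\<bar> \<le> u' - l'"
    using *(2) unfolding brackets_iff by (auto simp: abs_le_iff field_simps)
  then show ?thesis unfolding bisection_iterates_def by (simp add: * )
qed

lemma bisection_converges:
  assumes "brackets \<theta> (\<theta> d) l u" and "\<epsilon> > 0"
  shows "\<forall>\<^sub>F j in sequentially. accurate \<theta> d \<epsilon> (bisection_iterates \<theta> (\<theta> d) l u j)"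
proof -
  have "(\<lambda>j. (u - l) * (1 / 2) ^ j) \<longlonglongrightarrow> (u - l) * 0"
    by (intro tendsto_intros) auto
  then have "\<forall>\<^sub>F j in sequentially. (u - l) * (1 / 2) ^ j < \<epsilon>"
    using assms(2) by (auto dest: order_tendstoD(2))
  then show ?thesis
  proof eventually_elim
    case (elim j)
    then show ?case by (intro accurateI) (use bisection_error[OF assms(1), of j] in linarith)
  qed
qed

lemma bisection_iterations:
  assumes "brackets \<theta> (\<theta> d) l u"
  shows "(\<lambda>\<epsilon>. real (inner_iterations \<theta> d (bisection_iterates \<theta> (\<theta> d) l u) \<epsilon>))
    \<in> O[at_right 0](\<lambda>\<epsilon>. ln (1 / \<epsilon>))"
proof (rule inner_iterations_geometric[where C = "u - l"])
  show "0 < u - l" using assms by (simp add: brackets_def)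
  show "accurate \<theta> d \<epsilon> (bisection_iterates \<theta> (\<theta> d) l u j)" if "(u - l) * (1 / 2) ^ j \<le> \<epsilon>" for j \<epsilon>
    by (rule accurateI) (use bisection_error[OF assms, of j] that in linarith)
qed

lemma slope_lipschitz:
  assumes "0 < b" "b \<le> \<theta> x" "b \<le> \<theta> y"
  shows "\<bar>D x - D y\<bar> \<le> G / b\<^sup>2 * \<bar>x - y\<bar>"
  using slope_lipschitz_value[OF assms] slope_lipschitz_const_nonneg
    mult_left_mono[OF lipschitz[of x y], of "G / b\<^sup>2"] by simp

text \<open>
  The difference quotient at \<open>x\<close> lies between the subgradients \<open>D x\<close> and \<open>D y\<close>, which are close
  since \<open>D\<close> is Lipschitz where \<open>\<theta>\<close> is bounded away from 0.
\<close>

lemma has_derivative_slope: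
  assumes pos: "0 < \<theta> x"
  shows "(\<theta> has_real_derivative D x) (at x)"
proof -
  define b where "b = \<theta> x / 2"
  \<comment> \<open>As \<open>\<theta>\<close> is 1-Lipschitz, its values stay above \<open>b\<close> within distance \<open>b\<close> of \<open>x\<close>.\<close>
  have b: "0 < b" "b \<le> \<theta> x" using pos by (auto simp: b_def)
  have quot: "\<bar>(\<theta> y - \<theta> x) / (y - x) - D x\<bar> \<le> G / b\<^sup>2 * \<bar>y - x\<bar>"
    if y: "y \<noteq> x" "\<bar>y - x\<bar> < b" for y
  proof -
    have "b \<le> \<theta> y" using lipschitz[of y x] y by (auto simp: b_def abs_le_iff)
    then have lip: "\<bar>D y - D x\<bar> \<le> G / b\<^sup>2 * \<bar>y - x\<bar>" using slope_lipschitz b by blast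
    have lower: "D x * (y - x) \<le> \<theta> y - \<theta> x" using subgradient[of x y] by simp
    have upper: "\<theta> y - \<theta> x \<le> D y * (y - x)" using subgradient[of y x] by (simp add: algebra_simps)
    have "\<bar>(\<theta> y - \<theta> x) / (y - x) - D x\<bar> \<le> \<bar>D y - D x\<bar>"
    proof (cases "x < y")
      case True
      then have "D x \<le> (\<theta> y - \<theta> x) / (y - x)" "(\<theta> y - \<theta> x) / (y - x) \<le> D y"
        using lower upper by (simp_all add: pos_le_divide_eq pos_divide_le_eq)
      then show ?thesis by linarith
    next
      case False
      then have "(\<theta> y - \<theta> x) / (y - x) \<le> D x" "D y \<le> (\<theta> y - \<theta> x) / (y - x)"
        using lower upper y by (simp_all add: neg_le_divide_eq neg_divide_le_eq)
      then show ?thesis by linarith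
    qed
    then show ?thesis using lip by linarith
  qed
  have "((\<lambda>y. G / b\<^sup>2 * \<bar>y - x\<bar>) \<longlongrightarrow> G / b\<^sup>2 * \<bar>x - x\<bar>) (at x)"
    by (intro tendsto_intros)
  then have lim: "((\<lambda>y. G / b\<^sup>2 * \<bar>y - x\<bar>) \<longlongrightarrow> 0) (at x)" by simp
  have "((\<lambda>y. (\<theta> y - \<theta> x) / (y - x) - D x) \<longlongrightarrow> 0) (at x)"
  proof (rule Lim_null_comparison[OF _ lim])
    show "\<forall>\<^sub>F y in at x. norm ((\<theta> y - \<theta> x) / (y - x) - D x) \<le> G / b\<^sup>2 * \<bar>y - x\<bar>"
      unfolding eventually_at using b quot by (auto simp: dist_real_def)
  qed
  then show ?thesis unfolding has_field_derivative_iff using LIM_zero_iff by blast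
qed

definition newton_step :: "real \<Rightarrow> real" where
  "newton_step \<delta> = \<delta> - (\<theta> \<delta> - \<theta> d) / D \<delta>"

text \<open>
  The tangent takes the value \<open>\<theta> d\<close> at the next iterate and lies below \<open>\<theta>\<close>. From either side of
  the root, a step therefore ends at the root or to its left.
\<close>

lemma newton_step_le_root:
  assumes "0 < \<theta> \<delta>"
  shows "newton_step \<delta> \<le> d"
proof -
  have "\<theta> \<delta> + D \<delta> * (newton_step \<delta> - \<delta>) = \<theta> d"
    using slope_neg[OF assms] by (simp add: newton_step_def)
  then show ?thesis using subgradient[of \<delta> "newton_step \<delta>"] by (simp add: le_root_iff)
qed

text \<open>
  With \<open>e = d - \<delta>\<close>, the subgradient at the root gives \<open>\<theta> \<delta> - \<theta> d \<ge> - D d * e\<close>, so a step covers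
  at least the fraction \<open>D d / D \<delta>\<close> of the distance. This fraction is at least \<open>- D d\<close> since
  \<open>D \<delta> \<ge> - 1\<close>, which is global linear convergence. It also differs from 1 by
  \<open>(D \<delta> - D d) / D \<delta>\<close>, which is of order \<open>e\<close>: this is quadratic convergence.
\<close>

lemma newton_step_error:
  assumes "\<delta> \<le> d"
  shows "d - newton_step \<delta> \<le> (1 + D d) * (d - \<delta>)"
    and "d - newton_step \<delta> \<le> G / ((\<theta> d)\<^sup>2 * - D d) * (d - \<delta>)\<^sup>2"
proof -
  define e where "e = d - \<delta>"
  have e: "0 \<le> e" using assms by (simp add: e_def)
  have ge: "\<theta> d \<le> \<theta> \<delta>" using assms le_root_iff by simp
  have neg: "D d < 0" "D \<delta> < 0" using slope_neg root_pos ge by auto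
  have decrease: "- D d * e \<le> \<theta> \<delta> - \<theta> d" using subgradient[of d \<delta>] by (simp add: e_def algebra_simps)
  have slopes: "D \<delta> * e \<le> D d * e"
    using subgradient[of d \<delta>] subgradient[of \<delta> d] by (simp add: e_def algebra_simps)
  have "(\<theta> \<delta> - \<theta> d) / D \<delta> \<le> (- D d * e) / D \<delta>"
    using decrease neg by (intro divide_right_mono_neg) auto
  then have err: "d - newton_step \<delta> \<le> e - D d / D \<delta> * e"
    by (simp add: newton_step_def e_def)
  have "- D d \<le> D d / D \<delta>"
    using neg slope_ge[of \<delta>] mult_left_mono[of "- D \<delta>" 1 "- D d"] by (simp add: neg_le_divide_eq)
  then have "e - D d / D \<delta> * e \<le> (1 + D d) * e"
    using e mult_right_mono[of "- D d" "D d / D \<delta>" e] by (simp add: algebra_simps)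
  then show "d - newton_step \<delta> \<le> (1 + D d) * (d - \<delta>)" using err by (simp add: e_def)
  have lip: "D d - D \<delta> \<le> G / (\<theta> d)\<^sup>2 * e"
    using slope_lipschitz[OF root_pos ge order_refl] assms by (simp add: e_def abs_le_iff)
  have "e - D d / D \<delta> * e = ((D d - D \<delta>) * e) / - D \<delta>" using neg by (simp add: field_simps)
  also have "\<dots> \<le> ((D d - D \<delta>) * e) / - D d"
  proof (cases "e = 0")
    case False
    then have "D \<delta> \<le> D d" using slopes e by simp
    then show ?thesis using neg e by (intro divide_left_mono mult_nonneg_nonneg mult_pos_pos) auto
  qed simp
  also have "\<dots> \<le> (G / (\<theta> d)\<^sup>2 * e * e) / - D d"
    using lip e neg by (intro divide_right_mono mult_right_mono) auto
  also have "\<dots> = G / ((\<theta> d)\<^sup>2 * - D d) * (d - \<delta>)\<^sup>2"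
    using root_pos neg by (simp add: e_def power2_eq_square field_simps)
  finally show "d - newton_step \<delta> \<le> G / ((\<theta> d)\<^sup>2 * - D d) * (d - \<delta>)\<^sup>2" using err by simp
qed

lemma newton_iterates_funpow:
  assumes "0 < \<theta> \<delta>0"
  shows "newton_iterates \<theta> (\<theta> d) (\<lambda>j. (newton_step ^^ j) \<delta>0)"
    and "(newton_step ^^ Suc j) \<delta>0 \<le> d"
proof -
  have pos: "0 < \<theta> ((newton_step ^^ j) \<delta>0)" for j
  proof (induction j)
    case (Suc j)
    then show ?case
      using newton_step_le_root[OF Suc] root_pos le_root_iff[of "newton_step ((newton_step ^^ j) \<delta>0)"]
      by simp
  qed (use assms in simp)
  show "(newton_step ^^ Suc j) \<delta>0 \<le> d" using newton_step_le_root[OF pos] by simp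
  show "newton_iterates \<theta> (\<theta> d) (\<lambda>j. (newton_step ^^ j) \<delta>0)"
    unfolding newton_iterates_def
  proof (intro allI exI conjI)
    fix j
    show "(\<theta> has_real_derivative D ((newton_step ^^ j) \<delta>0)) (at ((newton_step ^^ j) \<delta>0))"
      by (rule has_derivative_slope[OF pos])
    show "D ((newton_step ^^ j) \<delta>0) \<noteq> 0" using slope_neg[OF pos[of j]] by simp
    show "(newton_step ^^ Suc j) \<delta>0 = (newton_step ^^ j) \<delta>0
        - (\<theta> ((newton_step ^^ j) \<delta>0) - \<theta> d) / D ((newton_step ^^ j) \<delta>0)"
      by (simp add: newton_step_def)
  qed
qed

lemma newton_tendsto:
  assumes "0 < \<theta> \<delta>0"
  shows "(\<lambda>j. (newton_step ^^ j) \<delta>0) \<longlonglongrightarrow> d"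
proof -
  define a where "a j = d - (newton_step ^^ Suc j) \<delta>0" for j
  have nonneg: "0 \<le> a j" for j unfolding a_def using newton_iterates_funpow(2)[OF assms, of j] by simp
  have q: "0 \<le> 1 + D d" "1 + D d < 1" using slope_ge[of d] slope_neg[OF root_pos] by auto
  have le: "a j \<le> a 0 * (1 + D d) ^ j" for j
  proof (induction j)
    case (Suc j)
    have "a (Suc j) \<le> (1 + D d) * a j"
      unfolding a_def using newton_step_error(1)[OF newton_iterates_funpow(2)[OF assms, of j]] by simp
    also have "\<dots> \<le> (1 + D d) * (a 0 * (1 + D d) ^ j)" using Suc q by (intro mult_left_mono)
    finally show ?case by (simp add: ac_simps)
  qed simp
  have "(\<lambda>j. a 0 * (1 + D d) ^ j) \<longlonglongrightarrow> a 0 * 0"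
    using q by (intro tendsto_intros) auto
  then have "a \<longlonglongrightarrow> 0"
    using nonneg le
    by (intro tendsto_sandwich[of "\<lambda>_. 0" a sequentially "\<lambda>j. a 0 * (1 + D d) ^ j"] always_eventually) auto
  then have "(\<lambda>j. d - a j) \<longlonglongrightarrow> d - 0" by (intro tendsto_intros)
  then show ?thesis unfolding a_def using filterlim_sequentially_Suc[of "\<lambda>j. (newton_step ^^ j) \<delta>0" "nhds d"] by simp
qed

lemma newton_converges:
  assumes "0 < \<theta> \<delta>0" and "\<epsilon> > 0"
  shows "\<forall>\<^sub>F j in sequentially. accurate \<theta> d \<epsilon> ((newton_step ^^ j) \<delta>0)"
  using tendstoD[OF newton_tendsto[OF assms(1)] assms(2)]
  by eventually_elim (auto simp: dist_real_def intro: accurateI)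

text \<open>
  Linear convergence eventually brings the error below \<open>1 / (2 * K)\<close>. From then on \<open>K\<close> times the
  error is at most \<open>1 / 2\<close> and is at least squared by each step.
\<close>

lemma newton_iterations:
  assumes "0 < \<theta> \<delta>0"
  shows "(\<lambda>\<epsilon>. real (inner_iterations \<theta> d (\<lambda>j. (newton_step ^^ j) \<delta>0) \<epsilon>))
    \<in> O[at_right 0](\<lambda>\<epsilon>. ln (ln (1 / \<epsilon>)))"
proof -
  \<comment> \<open>The summand 1 keeps \<open>K\<close> positive when \<open>G = 0\<close>.\<close>
  define K where "K = G / ((\<theta> d)\<^sup>2 * - D d) + 1"
  have "0 < (\<theta> d)\<^sup>2 * - D d" using root_pos slope_neg[OF root_pos] by (simp add: mult_pos_neg)
  then have K: "1 \<le> K" using slope_lipschitz_const_nonneg unfolding K_def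
    by (metis add.commute le_add_same_cancel1 divide_nonneg_pos)
  have "\<forall>\<^sub>F j in sequentially. dist ((newton_step ^^ j) \<delta>0) d < 1 / (2 * K)"
    using K by (intro tendstoD[OF newton_tendsto[OF assms]]) auto
  then obtain N where N: "\<And>j. j \<ge> N \<Longrightarrow> \<bar>(newton_step ^^ j) \<delta>0 - d\<bar> < 1 / (2 * K)"
    unfolding eventually_sequentially dist_real_def by blast
  \<comment> \<open>Starting at \<open>Suc N\<close> rather than \<open>N\<close> ensures that no iterate exceeds the root.\<close>
  define a where "a i = d - (newton_step ^^ (Suc N + i)) \<delta>0" for i
  have nonneg: "0 \<le> a i" for i
    unfolding a_def using newton_iterates_funpow(2)[OF assms, of "N + i"] by simp
  have step: "a (Suc i) \<le> K * (a i)\<^sup>2" for i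
  proof -
    have "a (Suc i) \<le> G / ((\<theta> d)\<^sup>2 * - D d) * (a i)\<^sup>2"
      unfolding a_def
      using newton_step_error(2)[OF newton_iterates_funpow(2)[OF assms, of "N + i"]] by simp
    also have "\<dots> \<le> K * (a i)\<^sup>2" unfolding K_def by (intro mult_right_mono) auto
    finally show ?thesis .
  qed
  have fast: "K * a i \<le> (1 / 2) ^ (2 ^ i)" for i
  proof (induction i)
    case 0
    have "a 0 \<le> 1 / (2 * K)" using N[of "Suc N"] unfolding a_def by simp
    then show ?case using K by (simp add: field_simps)
  next
    case (Suc i)
    have "K * a (Suc i) \<le> K * (K * (a i)\<^sup>2)" using step K by (intro mult_left_mono) auto
    also have "\<dots> = (K * a i)\<^sup>2" by (simp add: power2_eq_square)
    also have "\<dots> \<le> ((1 / 2) ^ (2 ^ i))\<^sup>2" using Suc nonneg K by (intro power_mono) auto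
    also have "\<dots> = (1 / 2) ^ (2 ^ Suc i)" by (simp add: power_mult[symmetric] mult.commute)
    finally show ?case .
  qed
  show ?thesis
  proof (rule inner_iterations_doubly_exponential[where K = K and J = "Suc N"])
    show "0 < K" using K by simp
    fix i and \<epsilon> :: real assume "(1 / 2) ^ (2 ^ i) \<le> K * \<epsilon>"
    then have "K * a i \<le> K * \<epsilon>" using fast[of i] by (rule order_trans[rotated])
    then have "a i \<le> \<epsilon>" using K by simp
    then show "accurate \<theta> d \<epsilon> ((newton_step ^^ (Suc N + i)) \<delta>0)"
      using nonneg[of i] unfolding a_def by (intro accurateI) auto
  qed
qed

end

section \<open>Minimising a quadratic form on the unit ball\<close>

text \<open>
  Otherwise moving from \<open>w\<close> a little against \<open>z = A w\<close> would make the form negative: its first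
  order change is \<open>- 2 s (z \<bullet> z)\<close>.
\<close>

lemma psd_null_vector:
  fixes A :: "real ^ 'm ^ 'm"
  assumes psd: "psd A" and null: "w \<bullet> (A *v w) = 0"
  shows "A *v w = 0"
proof (rule ccontr)
  define z where "z = A *v w"
  assume "A *v w \<noteq> 0"
  then have a: "0 < z \<bullet> z" by (simp add: z_def)
  have sym: "transpose A = A" and nonneg: "\<And>x. 0 \<le> x \<bullet> (A *v x)" using psd by (auto simp: psd_def)
  have "w \<bullet> (A *v z) = z \<bullet> z"
    using dot_lmul_matrix[of w A z] transpose_matrix_vector[of A w] sym by (simp add: z_def)
  then have expand: "(w + s *\<^sub>R z) \<bullet> (A *v (w + s *\<^sub>R z)) = 2 * s * (z \<bullet> z) + s\<^sup>2 * (z \<bullet> (A *v z))" for s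
    using null by (simp add: matrix_vector_right_distrib inner_add_left inner_add_right
        z_def[symmetric] power2_eq_square algebra_simps)
  define k where "k = z \<bullet> (A *v z)"
  \<comment> \<open>The step that nearly minimises \<open>2 * s * (z \<bullet> z) + s\<^sup>2 * k\<close>; adding 1 avoids dividing by 0.\<close>
  define s where "s = - (z \<bullet> z) / (k + 1)"
  have k: "0 \<le> k" using nonneg by (simp add: k_def)
  have s: "s * (k + 1) = - (z \<bullet> z)" using k by (simp add: s_def)
  have "s < 0" using a k by (simp add: s_def divide_neg_pos)
  have "2 * s * (z \<bullet> z) + s\<^sup>2 * k = s * ((z \<bullet> z) + (s * (k + 1) + (z \<bullet> z)) - s)"
    by (simp add: power2_eq_square algebra_simps)
  also have "\<dots> = s * ((z \<bullet> z) - s)" using s by simp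
  also have "\<dots> < 0" using \<open>s < 0\<close> a by (intro mult_neg_pos) linarith+
  finally show False using nonneg[of "w + s *\<^sub>R z"] expand[of s] by (simp add: k_def)
qed

lemma transpose_add: "transpose (A + B) = transpose A + transpose B"
  by (simp add: transpose_def vec_eq_iff)

lemma shift_mult:
  fixes A :: "real ^ 'm ^ 'm"
  shows "(A + c *\<^sub>R mat 1) *v x = A *v x + c *\<^sub>R x"
proof -
  have "(c *\<^sub>R mat 1) *v x = c *\<^sub>R x"
    by (simp only: scaleR_matrix_vector_assoc[symmetric] matrix_vector_mul_lid)
  then show ?thesis by (simp add: matrix_vector_mult_add_rdistrib)
qed

text \<open>
  Homogeneity extends the bound \<open>- \<theta>\<close> on the ball to \<open>- \<theta> * (norm y)\<^sup>2\<close> everywhere, which is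
  semidefiniteness of the shifted matrix. At the minimiser the shifted form equals
  \<open>- \<theta> * (1 - (norm w)\<^sup>2)\<close>, which is both nonpositive and nonnegative; this yields
  complementary slackness and, by \<open>psd_null_vector\<close>, the null vector equation.
\<close>

lemma ball_minimum_multiplier:
  fixes A :: "real ^ 'm ^ 'm"
  assumes sym: "transpose A = A"
    and min: "is_arg_min (\<lambda>w. w \<bullet> (A *v w)) (\<lambda>w. norm w \<le> 1) w"
    and \<theta>: "\<theta> = - (w \<bullet> (A *v w))"
  shows "0 \<le> \<theta>" and "psd (A + \<theta> *\<^sub>R mat 1)" and "(A + \<theta> *\<^sub>R mat 1) *v w = 0"
    and "\<theta> * (norm w - 1) = 0"
proof -
  have norm: "norm w \<le> 1" and le: "- \<theta> \<le> y \<bullet> (A *v y)" if "norm y \<le> 1" for y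
    using min that unfolding is_arg_min_def \<theta> by (auto simp: not_less)
  have "norm w \<le> 1" using norm[of 0] by simp
  show nonneg: "0 \<le> \<theta>" using le[of 0] by simp
  have quadratic: "- \<theta> * (norm y)\<^sup>2 \<le> y \<bullet> (A *v y)" for y
  proof (cases "y = 0")
    case False
    have "- \<theta> \<le> ((1 / norm y) *\<^sub>R y) \<bullet> (A *v ((1 / norm y) *\<^sub>R y))" using False by (intro le) simp
    also have "\<dots> = (y \<bullet> (A *v y)) / (norm y)\<^sup>2"
      by (simp add: matrix_vector_mult_scaleR power2_eq_square)
    finally show ?thesis using False by (simp add: pos_le_divide_eq)
  qed simp
  show psd: "psd (A + \<theta> *\<^sub>R mat 1)"
    unfolding psd_def
  proof (intro conjI allI)
    show "transpose (A + \<theta> *\<^sub>R mat 1) = A + \<theta> *\<^sub>R mat 1"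
      by (simp add: transpose_add transpose_scalar sym)
    show "0 \<le> y \<bullet> ((A + \<theta> *\<^sub>R mat 1) *v y)" for y
      using quadratic[of y] by (simp add: shift_mult inner_add_right power2_norm_eq_inner)
  qed
  have val: "w \<bullet> ((A + \<theta> *\<^sub>R mat 1) *v w) = - \<theta> * (1 - (norm w)\<^sup>2)"
    unfolding shift_mult by (simp add: inner_add_right \<theta> power2_norm_eq_inner algebra_simps)
  have "(norm w)\<^sup>2 \<le> 1" using \<open>norm w \<le> 1\<close> by (simp add: power_le_one)
  then have zero: "\<theta> * (1 - (norm w)\<^sup>2) = 0"
    using val psd nonneg unfolding psd_def
    by (metis antisym diff_ge_0_iff_ge minus_mult_left mult_nonneg_nonneg neg_0_le_iff_le)
  then show "(A + \<theta> *\<^sub>R mat 1) *v w = 0" using psd_null_vector[OF psd] val by simp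
  show "\<theta> * (norm w - 1) = 0"
  proof -
    have "\<theta> = 0 \<or> (norm w)\<^sup>2 = 1" using zero by auto
    then show ?thesis using power2_eq_1_iff[of "norm w"] norm_ge_zero[of w] by auto
  qed
qed

text \<open>
  The converse: the optimality conditions are sufficient, and they determine the multiplier as
  the negated minimum. This is why the multiplier does not depend on the solution.
\<close>

lemma multiplier_ball_minimum:
  fixes A :: "real ^ 'm ^ 'm"
  assumes nonneg: "0 \<le> \<theta>" and psd: "psd (A + \<theta> *\<^sub>R mat 1)"
    and null: "(A + \<theta> *\<^sub>R mat 1) *v w = 0" and slack: "\<theta> * (norm w - 1) = 0"
    and norm: "norm w \<le> 1"
  shows "w \<bullet> (A *v w) = - \<theta>" and "is_arg_min (\<lambda>w. w \<bullet> (A *v w)) (\<lambda>w. norm w \<le> 1) w"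
proof -
  have form: "y \<bullet> ((A + \<theta> *\<^sub>R mat 1) *v y) = y \<bullet> (A *v y) + \<theta> * (norm y)\<^sup>2" for y
    by (simp add: shift_mult inner_add_right power2_norm_eq_inner)
  have "\<theta> = 0 \<or> norm w = 1" using slack by auto
  then have "\<theta> * (norm w)\<^sup>2 = \<theta>" by auto
  then show val: "w \<bullet> (A *v w) = - \<theta>" using form[of w] null by (simp only: inner_zero_right)
  have "- \<theta> \<le> y \<bullet> (A *v y)" if "norm y \<le> 1" for y
  proof -
    have "\<theta> * (norm y)\<^sup>2 \<le> \<theta>" using that nonneg by (intro mult_left_le) (auto simp: power_le_one)
    moreover have "0 \<le> y \<bullet> ((A + \<theta> *\<^sub>R mat 1) *v y)" using psd by (simp add: psd_def)
    ultimately show ?thesis using form[of y] by simp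
  qed
  then show "is_arg_min (\<lambda>w. w \<bullet> (A *v w)) (\<lambda>w. norm w \<le> 1) w"
    using norm val by (auto simp: is_arg_min_def not_less)
qed

section \<open>The homogeneous model\<close>

lemma sum_option: "sum h (UNIV :: 'n::finite option set) = h None + (\<Sum>i\<in>UNIV. h (Some i))"
  by (simp add: UNIV_option_conv sum.reindex)

lemma stack_inner: "stack v t \<bullet> stack v' t' = v \<bullet> v' + t * t'"
  by (simp add: inner_vec_def sum_option stack_def)

lemma stack_surj: "\<exists>v t. w = stack v t"
  by (intro exI[of _ "\<chi> a. w $ Some a"] exI[of _ "w $ None"])
     (auto simp: stack_def vec_eq_iff split: option.split)

lemma stack_eq_0_iff: "stack v t = 0 \<longleftrightarrow> v = 0 \<and> t = 0"
  by (auto simp: stack_def vec_eq_iff split: option.split)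

lemma norm_stack: "(norm (stack v t))\<^sup>2 = (norm v)\<^sup>2 + t\<^sup>2"
  by (simp only: power2_norm_eq_inner stack_inner) (simp add: power2_eq_square)

lemma hom_matrix_mult: "hom_matrix H g \<delta> *v stack v t = stack (H *v v + t *\<^sub>R g) (g \<bullet> v + \<delta> * t)"
  by (auto simp: vec_eq_iff matrix_vector_mult_def sum_option hom_matrix_def stack_def inner_vec_def
      split: option.split)

lemma hom_shift_mult:
  "(hom_matrix H g \<delta> + \<theta> *\<^sub>R mat 1) *v stack v t
    = stack (H *v v + t *\<^sub>R g + \<theta> *\<^sub>R v) (g \<bullet> v + \<delta> * t + \<theta> * t)"
  unfolding shift_mult hom_matrix_mult by (simp add: stack_def vec_eq_iff split: option.split)

lemma transpose_hom_matrix: "transpose H = H \<Longrightarrow> transpose (hom_matrix H g \<delta>) = hom_matrix H g \<delta>"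
  by (auto simp: vec_eq_iff transpose_def hom_matrix_def split: option.split)

text \<open>
  The model value at a fixed point is affine in \<open>\<delta>\<close>. All monotonicity and convexity of the
  multiplier comes from this identity.
\<close>

lemma hom_form_slope:
  "stack v t \<bullet> (hom_matrix H g \<delta>' *v stack v t)
    = stack v t \<bullet> (hom_matrix H g \<delta> *v stack v t) + t\<^sup>2 * (\<delta>' - \<delta>)"
  by (simp add: hom_matrix_mult stack_inner power2_eq_square algebra_simps)

lemma hom_solution_exists: "\<exists>v t. hom_solution H g \<delta> v t"
proof -
  let ?q = "\<lambda>w. w \<bullet> (hom_matrix H g \<delta> *v w)"
  have "continuous_on (cball 0 1) ?q"
    by (intro continuous_intros linear_continuous_on linear_linear[THEN iffD2]) simp
  then obtain w where "w \<in> cball 0 1" "\<forall>y\<in>cball 0 1. ?q w \<le> ?q y"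
    using continuous_attains_inf[of "cball 0 1" ?q] by auto
  then have "is_arg_min ?q (\<lambda>w. norm w \<le> 1) w" by (auto simp: is_arg_min_def not_less)
  then show ?thesis unfolding hom_solution_def using stack_surj[of w] by auto
qed

text \<open>
  All solutions attain the same minimum, so the definite description in the definition of the
  multiplier denotes the negated minimum.
\<close>

lemma hom_multiplier_eq:
  assumes sym: "transpose H = H" and sol: "hom_solution H g \<delta> v t"
  shows "hom_multiplier H g \<delta> = - (stack v t \<bullet> (hom_matrix H g \<delta> *v stack v t))"
    and "is_multiplier H g \<delta> v t (hom_multiplier H g \<delta>)"
proof -
  let ?q = "\<lambda>w. w \<bullet> (hom_matrix H g \<delta> *v w)"
  have mult: "is_multiplier H g \<delta> v t (- ?q (stack v t))"
    using ball_minimum_multiplier[OF transpose_hom_matrix[OF sym] sol[unfolded hom_solution_def] refl]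
    by (simp add: is_multiplier_def)
  have "hom_multiplier H g \<delta> = - ?q (stack v t)"
    unfolding hom_multiplier_def
  proof (rule the_equality)
    show "\<exists>v' t'. hom_solution H g \<delta> v' t' \<and> is_multiplier H g \<delta> v' t' (- ?q (stack v t))"
      using sol mult by blast
  next
    fix \<theta> assume "\<exists>v' t'. hom_solution H g \<delta> v' t' \<and> is_multiplier H g \<delta> v' t' \<theta>"
    then obtain v' t' where *: "hom_solution H g \<delta> v' t'" "is_multiplier H g \<delta> v' t' \<theta>" by blast
    have "?q (stack v' t') = - \<theta>"
      using * unfolding is_multiplier_def hom_solution_def is_arg_min_def
      by (intro multiplier_ball_minimum(1)) auto
    moreover have "?q (stack v' t') = ?q (stack v t)"
      using *(1) sol unfolding hom_solution_def is_arg_min_def by (meson linorder_neqE)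
    ultimately show "\<theta> = - ?q (stack v t)" by simp
  qed
  then show "hom_multiplier H g \<delta> = - ?q (stack v t)"
    and "is_multiplier H g \<delta> v t (hom_multiplier H g \<delta>)" using mult by auto
qed

lemma hom_multiplier_ge:
  assumes "transpose H = H" and "norm w \<le> 1"
  shows "- (w \<bullet> (hom_matrix H g \<delta> *v w)) \<le> hom_multiplier H g \<delta>"
proof -
  obtain v t where sol: "hom_solution H g \<delta> v t" using hom_solution_exists by blast
  then show ?thesis
    using hom_multiplier_eq(1)[OF assms(1) sol] assms(2)
    unfolding hom_solution_def is_arg_min_def by (auto simp: not_less)
qed

lemma hom_multiplierI:
  assumes "transpose H = H" and "is_multiplier H g \<delta> v t \<theta>" and "norm (stack v t) \<le> 1"
  shows "hom_multiplier H g \<delta> = \<theta>"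
proof -
  have "stack v t \<bullet> (hom_matrix H g \<delta> *v stack v t) = - \<theta>" "hom_solution H g \<delta> v t"
    using assms(2,3) multiplier_ball_minimum[of \<theta> "hom_matrix H g \<delta>" "stack v t"]
    unfolding hom_solution_def is_multiplier_def by auto
  then show ?thesis using hom_multiplier_eq(1)[OF assms(1)] by simp
qed

text \<open>
  Testing the equation with \<open>s\<close> itself bounds the resolvent of a positive semidefinite matrix
  by \<open>1 / \<theta>\<close>.
\<close>

lemma psd_shift_solution_bound:
  assumes "psd H" and "0 < \<theta>" and "H *v s + \<theta> *\<^sub>R s = b"
  shows "\<theta> * norm s \<le> norm b"
proof (cases "s = 0")
  case False
  have "\<theta> * (norm s)\<^sup>2 \<le> s \<bullet> (H *v s + \<theta> *\<^sub>R s)"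
    using assms(1) by (simp add: psd_def inner_add_right power2_norm_eq_inner)
  also have "\<dots> \<le> norm s * norm b" unfolding assms(3) by (rule norm_cauchy_schwarz)
  finally have "norm s * (\<theta> * norm s) \<le> norm s * norm b" by (simp add: power2_eq_square ac_simps)
  then show ?thesis using False by simp
qed simp

lemma psd_shift_invertible:
  fixes H :: "real ^ 'n ^ 'n"
  assumes "psd H" and "0 < c"
  shows "invertible (H + c *\<^sub>R mat 1)"
proof -
  have "x = 0" if "(H + c *\<^sub>R mat 1) *v x = 0" for x
    using psd_shift_solution_bound[OF assms, of x 0] that assms(2)
    by (simp add: shift_mult mult_le_0_iff)
  then have "inj ((*v) (H + c *\<^sub>R mat 1))"
    using linear_injective_0[OF matrix_vector_mul_linear] by blast
  then show ?thesis by (simp add: invertible_left_inverse matrix_left_invertible_injective)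
qed

lemma matrix_inv_solution:
  fixes A :: "real ^ 'n ^ 'n"
  assumes "invertible A"
  shows "A *v y = b \<longleftrightarrow> y = matrix_inv A *v b"
proof -
  have "A ** matrix_inv A = mat 1 \<and> matrix_inv A ** A = mat 1"
    unfolding matrix_inv_def using assms unfolding invertible_def by (rule someI_ex)
  then show ?thesis by (metis matrix_vector_mul_assoc matrix_vector_mul_lid)
qed

text \<open>
  A positive multiplier forces a solution of norm 1 in the null space of the shifted matrix. If
  \<open>t\<close> were 0, the upper block would make \<open>v\<close> a null vector of a positive definite matrix, so the
  solution would vanish. The vector \<open>- v / t\<close> is the negated step, and it fixes \<open>t\<^sup>2\<close> through
  \<open>(norm v)\<^sup>2 + t\<^sup>2 = 1\<close>.
\<close>

lemma hom_solution_positive_multiplier: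
  assumes psd: "psd H" and sol: "hom_solution H g \<delta> v t" and pos: "0 < hom_multiplier H g \<delta>"
  shows "t \<noteq> 0"
    and "H *v (- (1 / t) *\<^sub>R v) + hom_multiplier H g \<delta> *\<^sub>R (- (1 / t) *\<^sub>R v) = g"
    and "t\<^sup>2 = 1 / (1 + (norm (- (1 / t) *\<^sub>R v))\<^sup>2)"
proof -
  let ?\<theta> = "hom_multiplier H g \<delta>"
  have "is_multiplier H g \<delta> v t ?\<theta>" using hom_multiplier_eq(2) psd sol by (auto simp: psd_def)
  then have null: "H *v v + t *\<^sub>R g + ?\<theta> *\<^sub>R v = 0" and norm: "norm (stack v t) = 1"
    using pos by (auto simp: is_multiplier_def hom_shift_mult stack_eq_0_iff)
  have unit: "(norm v)\<^sup>2 + t\<^sup>2 = 1" using norm_stack[of v t] norm by simp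
  show t: "t \<noteq> 0"
  proof
    assume "t = 0"
    then have "?\<theta> * norm v \<le> 0" using psd_shift_solution_bound[OF psd pos, of v 0] null by simp
    then have "v = 0" using pos by (simp add: mult_le_0_iff)
    then show False using unit \<open>t = 0\<close> by simp
  qed
  have "H *v v + ?\<theta> *\<^sub>R v = - t *\<^sub>R g"
    using null by (simp add: eq_neg_iff_add_eq_0 algebra_simps)
  then have "- (1 / t) *\<^sub>R (H *v v + ?\<theta> *\<^sub>R v) = g" using t by simp
  then show "H *v (- (1 / t) *\<^sub>R v) + ?\<theta> *\<^sub>R (- (1 / t) *\<^sub>R v) = g"
    by (simp only: matrix_vector_mult_scaleR scaleR_add_right scaleR_left_commute)
  have "(norm (- (1 / t) *\<^sub>R v))\<^sup>2 = (norm v)\<^sup>2 / t\<^sup>2" by (simp add: power_divide)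
  then have "1 + (norm (- (1 / t) *\<^sub>R v))\<^sup>2 = 1 / t\<^sup>2" using unit t by (simp add: field_simps)
  then show "t\<^sup>2 = 1 / (1 + (norm (- (1 / t) *\<^sub>R v))\<^sup>2)" by simp
qed

text \<open>
  The factor \<open>(p + q) / ((1 + p\<^sup>2) * (1 + q\<^sup>2))\<close> that relates the two differences is at most 1,
  by \<open>2 * p \<le> 1 + p\<^sup>2\<close> and \<open>2 * q \<le> 1 + q\<^sup>2\<close>.
\<close>

lemma reciprocal_lipschitz:
  fixes p q :: real
  assumes "0 \<le> p" "0 \<le> q"
  shows "\<bar>1 / (1 + p\<^sup>2) - 1 / (1 + q\<^sup>2)\<bar> \<le> \<bar>p - q\<bar>"
proof -
  have pos: "0 < 1 + p\<^sup>2" "0 < 1 + q\<^sup>2" by (smt (verit) zero_le_power2)+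
  have "p + q \<le> (1 + p\<^sup>2) * (1 + q\<^sup>2)"
  proof -
    have "p \<le> (1 + p\<^sup>2) / 2" "q \<le> (1 + q\<^sup>2) / 2"
      using zero_le_power2[of "p - 1"] zero_le_power2[of "q - 1"] by (simp_all add: power2_eq_square algebra_simps)
    then have "p + q \<le> 1 + p\<^sup>2 + q\<^sup>2"
      using zero_le_power2[of p] zero_le_power2[of q] by argo
    also have "\<dots> \<le> (1 + p\<^sup>2) * (1 + q\<^sup>2)" by (simp add: algebra_simps)
    finally show ?thesis .
  qed
  then have ratio: "(p + q) / ((1 + p\<^sup>2) * (1 + q\<^sup>2)) \<le> 1" using pos by simp
  have "1 / (1 + p\<^sup>2) - 1 / (1 + q\<^sup>2) = (q - p) * ((p + q) / ((1 + p\<^sup>2) * (1 + q\<^sup>2)))"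
    using pos by (simp add: field_simps power2_eq_square)
  then have "\<bar>1 / (1 + p\<^sup>2) - 1 / (1 + q\<^sup>2)\<bar> = \<bar>p - q\<bar> * ((p + q) / ((1 + p\<^sup>2) * (1 + q\<^sup>2)))"
    using assms pos by (simp add: abs_mult abs_minus_commute)
  also have "\<dots> \<le> \<bar>p - q\<bar> * 1" using ratio by (intro mult_left_mono) auto
  finally show ?thesis by simp
qed

text \<open>
  The resolvent identity \<open>(H + \<theta> I) (s - s') = (\<theta>' - \<theta>) s'\<close> and two applications of the
  resolvent bound give \<open>norm (s - s') \<le> norm g / b\<^sup>2 * \<bar>\<theta> - \<theta>'\<bar>\<close>. The function
  \<open>s \<mapsto> 1 / (1 + (norm s)\<^sup>2)\<close> is 1-Lipschitz and carries this bound over to \<open>t\<^sup>2\<close>.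
\<close>

lemma hom_slope_lipschitz:
  assumes psd: "psd H" and b: "0 < b"
    and sol: "hom_solution H g \<delta> v t" "hom_solution H g \<delta>' v' t'"
    and ge: "b \<le> hom_multiplier H g \<delta>" "b \<le> hom_multiplier H g \<delta>'"
  shows "\<bar>t\<^sup>2 - t'\<^sup>2\<bar> \<le> norm g / b\<^sup>2 * \<bar>hom_multiplier H g \<delta> - hom_multiplier H g \<delta>'\<bar>"
proof -
  define \<theta> \<theta>' where "\<theta> = hom_multiplier H g \<delta>" and "\<theta>' = hom_multiplier H g \<delta>'"
  have pos: "0 < \<theta>" "0 < \<theta>'" using b ge by (auto simp: \<theta>_def \<theta>'_def)
  define s s' where "s = - (1 / t) *\<^sub>R v" and "s' = - (1 / t') *\<^sub>R v'"
  have s: "H *v s + \<theta> *\<^sub>R s = g" "t\<^sup>2 = 1 / (1 + (norm s)\<^sup>2)"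
    using hom_solution_positive_multiplier(2,3)[OF psd sol(1)] pos unfolding s_def \<theta>_def by blast+
  have s': "H *v s' + \<theta>' *\<^sub>R s' = g" "t'\<^sup>2 = 1 / (1 + (norm s')\<^sup>2)"
    using hom_solution_positive_multiplier(2,3)[OF psd sol(2)] pos unfolding s'_def \<theta>'_def by blast+
  have "H *v (s - s') + \<theta> *\<^sub>R (s - s') = (H *v s + \<theta> *\<^sub>R s) - (H *v s' + \<theta>' *\<^sub>R s') + (\<theta>' - \<theta>) *\<^sub>R s'"
    by (simp add: algebra_simps)
  also have "\<dots> = (\<theta>' - \<theta>) *\<^sub>R s'" using s s' by simp
  finally have "\<theta> * norm (s - s') \<le> norm ((\<theta>' - \<theta>) *\<^sub>R s')"
    by (rule psd_shift_solution_bound[OF psd pos(1)])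
  moreover have "b * norm (s - s') \<le> \<theta> * norm (s - s')"
    using ge by (intro mult_right_mono) (auto simp: \<theta>_def)
  ultimately have diff: "b * norm (s - s') \<le> \<bar>\<theta> - \<theta>'\<bar> * norm s'" by (simp add: abs_minus_commute)
  have "b * norm s' \<le> \<theta>' * norm s'" using ge by (intro mult_right_mono) (auto simp: \<theta>'_def)
  also have "\<dots> \<le> norm g" by (rule psd_shift_solution_bound[OF psd pos(2) s'(1)])
  finally have "\<bar>\<theta> - \<theta>'\<bar> * (b * norm s') \<le> \<bar>\<theta> - \<theta>'\<bar> * norm g" by (intro mult_left_mono) auto
  then have "b * (\<bar>\<theta> - \<theta>'\<bar> * norm s') \<le> norm g * \<bar>\<theta> - \<theta>'\<bar>"
    by (simp only: ac_simps)
  moreover have "b * (b * norm (s - s')) \<le> b * (\<bar>\<theta> - \<theta>'\<bar> * norm s')"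
    using diff b by (intro mult_left_mono) auto
  ultimately have "b\<^sup>2 * norm (s - s') \<le> norm g * \<bar>\<theta> - \<theta>'\<bar>"
    unfolding power2_eq_square mult.assoc by linarith
  then have resolvent: "norm (s - s') \<le> norm g / b\<^sup>2 * \<bar>\<theta> - \<theta>'\<bar>" using b by (simp add: field_simps)
  have "\<bar>t\<^sup>2 - t'\<^sup>2\<bar> \<le> \<bar>norm s - norm s'\<bar>" unfolding s(2) s'(2) by (rule reciprocal_lipschitz) auto
  also have "\<dots> \<le> norm (s - s')" by (rule norm_triangle_ineq3)
  finally show ?thesis using resolvent by (simp add: \<theta>_def \<theta>'_def)
qed

text \<open>
  For \<open>s\<close> with \<open>(H + c I) s = g\<close> and \<open>\<delta> = g \<bullet> s - c\<close>, completing the square turns the shifted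
  form at \<open>[v; t]\<close> into \<open>(v + t s) \<bullet> (H + c I) (v + t s)\<close>. It is nonnegative and vanishes on the
  line through \<open>[- s; 1]\<close>, so \<open>c\<close> and the unit vector on this line satisfy the optimality
  conditions.
\<close>

lemma hom_multiplier_attained:
  fixes H :: "real ^ 'n ^ 'n"
  assumes psd: "psd H" and c: "0 < c"
  obtains \<delta> where "hom_multiplier H g \<delta> = c"
proof -
  have sym: "transpose H = H" using psd by (simp add: psd_def)
  obtain s where s: "H *v s + c *\<^sub>R s = g"
    using matrix_inv_solution[OF psd_shift_invertible[OF psd c], of _ g] by (metis shift_mult)
  define \<delta> where "\<delta> = g \<bullet> s - c"
  define a where "a = 1 / sqrt (1 + (norm s)\<^sup>2)"
  have n: "0 < 1 + (norm s)\<^sup>2" by (smt (verit) zero_le_power2)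
  have Hs: "u \<bullet> (H *v s) = s \<bullet> (H *v u)" for u
    using dot_lmul_matrix[of s H u] transpose_matrix_vector[of H s] sym by (simp add: inner_commute)
  have square: "stack v t \<bullet> ((hom_matrix H g \<delta> + c *\<^sub>R mat 1) *v stack v t)
      = (v + t *\<^sub>R s) \<bullet> (H *v (v + t *\<^sub>R s)) + c * (norm (v + t *\<^sub>R s))\<^sup>2" for v t
    unfolding hom_shift_mult stack_inner \<delta>_def s[symmetric] power2_norm_eq_inner
    using Hs[of v] Hs[of s]
    by (simp add: inner_add_left inner_add_right matrix_vector_right_distrib matrix_vector_mult_scaleR
        inner_commute[of s v] inner_commute[of "H *v s"] algebra_simps)
  have "is_multiplier H g \<delta> (- a *\<^sub>R s) a c"
    unfolding is_multiplier_def
  proof (intro conjI)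
    show "psd (hom_matrix H g \<delta> + c *\<^sub>R mat 1)"
      unfolding psd_def
    proof (intro conjI allI)
      show "transpose (hom_matrix H g \<delta> + c *\<^sub>R mat 1) = hom_matrix H g \<delta> + c *\<^sub>R mat 1"
        by (simp add: transpose_add transpose_scalar transpose_hom_matrix sym)
      fix w :: "real ^ 'n option"
      obtain v t where "w = stack v t" using stack_surj by blast
      then show "0 \<le> w \<bullet> ((hom_matrix H g \<delta> + c *\<^sub>R mat 1) *v w)"
        using square[of v t] psd c by (simp add: psd_def)
    qed
    have "H *v (- a *\<^sub>R s) = - a *\<^sub>R (H *v s)" by (rule matrix_vector_mult_scaleR)
    then have "H *v (- a *\<^sub>R s) + a *\<^sub>R g + c *\<^sub>R (- a *\<^sub>R s) = a *\<^sub>R (g - (H *v s + c *\<^sub>R s))"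
      by (simp add: algebra_simps)
    then show "(hom_matrix H g \<delta> + c *\<^sub>R mat 1) *v stack (- a *\<^sub>R s) a = 0"
      unfolding hom_shift_mult stack_eq_0_iff s \<delta>_def by (simp add: algebra_simps)
    have "(norm (stack (- a *\<^sub>R s) a))\<^sup>2 = a\<^sup>2 * (1 + (norm s)\<^sup>2)"
      by (simp add: norm_stack power_mult_distrib algebra_simps)
    also have "\<dots> = 1" using n by (simp add: a_def power_divide)
    finally have unit: "norm (stack (- a *\<^sub>R s) a) = 1"
      using power2_eq_1_iff[of "norm (stack (- a *\<^sub>R s) a)"] norm_ge_zero[of "stack (- a *\<^sub>R s) a"]
      by linarith
    then show "c * (norm (stack (- a *\<^sub>R s) a) - 1) = 0" by simp
  qed (use c in simp)
  moreover from this have "norm (stack (- a *\<^sub>R s) a) \<le> 1" using c by (simp add: is_multiplier_def)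
  ultimately show ?thesis using that hom_multiplierI[OF sym] by blast
qed

section \<open>The Hessian of a convex function\<close>

lemma GDERIV_line:
  fixes f :: "'a::real_inner \<Rightarrow> real"
  assumes "\<And>y. GDERIV f y :> grad y"
  shows "((\<lambda>s. f (p + s *\<^sub>R h)) has_real_derivative grad (p + s *\<^sub>R h) \<bullet> h) (at s)"
proof -
  have "((\<lambda>s. f (p + s *\<^sub>R h)) has_derivative (\<lambda>k. (k *\<^sub>R h) \<bullet> grad (p + s *\<^sub>R h))) (at s)"
    by (rule has_derivative_compose[where f = "\<lambda>s. p + s *\<^sub>R h" and g = f])
       (use assms in \<open>auto simp: gderiv_def intro!: derivative_eq_intros\<close>)
  also have "(\<lambda>k. (k *\<^sub>R h) \<bullet> grad (p + s *\<^sub>R h)) = (*) (grad (p + s *\<^sub>R h) \<bullet> h)"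
    by (simp add: fun_eq_iff inner_commute)
  finally show ?thesis by (simp only: has_field_derivative_def)
qed

text \<open>
  Each of the two tangents, restricted to the segment between the points, lies below the
  function; adding the two inequalities cancels the function values.
\<close>

lemma gradient_monotone:
  fixes f :: "'a::real_inner \<Rightarrow> real"
  assumes convex: "convex_on UNIV f" and grad: "\<And>y. GDERIV f y :> grad y"
  shows "0 \<le> (grad y - grad z) \<bullet> (y - z)"
proof -
  have tangent: "grad p \<bullet> (q - p) \<le> f q - f p" for p q
  proof -
    define \<phi> where "\<phi> s = f (p + s *\<^sub>R (q - p))" for s :: real
    have "convex_on UNIV \<phi>"
    proof (rule convex_onI)
      fix t a b :: real assume t: "0 < t" "t < 1"
      have "p + ((1 - t) *\<^sub>R a + t *\<^sub>R b) *\<^sub>R (q - p)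
          = (1 - t) *\<^sub>R (p + a *\<^sub>R (q - p)) + t *\<^sub>R (p + b *\<^sub>R (q - p))"
        by (simp add: algebra_simps)
      then show "\<phi> ((1 - t) *\<^sub>R a + t *\<^sub>R b) \<le> (1 - t) * \<phi> a + t * \<phi> b"
        unfolding \<phi>_def using convex_onD[OF convex, of t] t by simp
    qed simp
    then have "(grad (p + 0 *\<^sub>R (q - p)) \<bullet> (q - p)) * (1 - 0) \<le> \<phi> 1 - \<phi> 0"
      unfolding \<phi>_def
      by (rule convex_on_imp_above_tangent) (use GDERIV_line[OF grad, of p "q - p" 0] in auto)
    then show ?thesis by (simp add: \<phi>_def)
  qed
  from tangent[of y z] tangent[of z y] show ?thesis by (simp add: algebra_simps inner_diff_left inner_diff_right)
qed

lemma has_derivative_remainder_bound: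
  fixes G :: "'a::real_normed_vector \<Rightarrow> 'b::real_normed_vector"
  assumes "(G has_derivative L) (at x)" and "e > 0"
  obtains r where "r > 0"
    "\<And>k. norm k < r \<Longrightarrow> norm (G (x + k) - G x - L k) \<le> e * norm k"
proof -
  obtain r where "r > 0" "\<And>y. norm (y - x) < r \<Longrightarrow> norm (G y - G x - L (y - x)) \<le> e * norm (y - x)"
    using assms unfolding has_derivative_at_alt by meson
  then show ?thesis using that[of r] by (metis add_diff_cancel_left')
qed

text \<open>
  Along a short step \<open>s h\<close> monotonicity of the gradient reads
  \<open>0 \<le> s\<^sup>2 * (h \<bullet> (H *v h))\<close> up to an error \<open>e * s\<^sup>2 * (norm h)\<^sup>2\<close> with \<open>e\<close> as small as desired.
\<close>

lemma hessian_psd: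
  fixes f :: "real ^ 'n \<Rightarrow> real"
  assumes convex: "convex_on UNIV f" and grad: "\<And>y. GDERIV f y :> grad y"
    and hess: "(grad has_derivative (\<lambda>h. H *v h)) (at x)"
  shows "0 \<le> h \<bullet> (H *v h)"
proof -
  have "- (e * (norm h)\<^sup>2) \<le> h \<bullet> (H *v h)" if e: "e > 0" for e :: real
  proof -
    obtain r where r: "r > 0" "\<And>k. norm k < r \<Longrightarrow> norm (grad (x + k) - grad x - H *v k) \<le> e * norm k"
      using has_derivative_remainder_bound[OF hess e] by blast
    \<comment> \<open>Any positive \<open>s\<close> with \<open>s * norm h < r\<close> will do; adding 1 covers \<open>h = 0\<close>.\<close>
    define s where "s = r / (2 * (norm h + 1))"
    have nh: "0 < norm h + 1" by (smt (verit) norm_ge_zero)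
    have s: "0 < s" using r nh by (simp add: s_def)
    have "norm (s *\<^sub>R h) = r * (norm h / (2 * (norm h + 1)))" using r s by (simp add: s_def)
    also have "\<dots> < r * 1" using r nh by (intro mult_strict_left_mono) (auto simp: field_simps)
    finally have err: "norm (grad (x + s *\<^sub>R h) - grad x - H *v (s *\<^sub>R h)) \<le> e * norm (s *\<^sub>R h)"
      using r(2)[of "s *\<^sub>R h"] by linarith
    have "0 \<le> (grad (x + s *\<^sub>R h) - grad x) \<bullet> (s *\<^sub>R h)"
      using gradient_monotone[OF convex grad, of "x + s *\<^sub>R h" x] by simp
    also have "\<dots> = (grad (x + s *\<^sub>R h) - grad x - H *v (s *\<^sub>R h)) \<bullet> (s *\<^sub>R h) + s\<^sup>2 * (h \<bullet> (H *v h))"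
      by (simp add: inner_diff_left inner_commute[of h] power2_eq_square algebra_simps)
    also have "\<dots> \<le> e * norm (s *\<^sub>R h) * norm (s *\<^sub>R h) + s\<^sup>2 * (h \<bullet> (H *v h))"
      using norm_cauchy_schwarz[of "grad (x + s *\<^sub>R h) - grad x - H *v (s *\<^sub>R h)" "s *\<^sub>R h"]
        mult_right_mono[OF err, of "norm (s *\<^sub>R h)"] by simp
    also have "\<dots> = s\<^sup>2 * (e * (norm h)\<^sup>2 + h \<bullet> (H *v h))"
      by (simp add: power2_eq_square algebra_simps)
    finally show ?thesis using s by (simp add: zero_le_mult_iff)
  qed
  note bound = this
  show ?thesis
  proof (rule ccontr)
    assume neg: "\<not> 0 \<le> h \<bullet> (H *v h)"
    define e where "e = - (h \<bullet> (H *v h)) / (2 * ((norm h)\<^sup>2 + 1))"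
    have n: "0 < (norm h)\<^sup>2 + 1" by (smt (verit) zero_le_power2)
    have e: "e > 0" using neg n by (simp add: e_def divide_neg_pos)
    have "e * ((norm h)\<^sup>2 + 1) = - (h \<bullet> (H *v h)) / 2" using n by (simp add: e_def divide_simps)
    then show False using bound[OF e] e neg by (simp add: algebra_simps)
  qed
qed

definition second_difference :: "('a::real_vector \<Rightarrow> real) \<Rightarrow> 'a \<Rightarrow> 'a \<Rightarrow> 'a \<Rightarrow> real" where
  "second_difference f x u v = f (x + u + v) - f (x + u) - f (x + v) + f x"

lemma second_difference_commute: "second_difference f x u v = second_difference f x v u"
  by (simp add: second_difference_def algebra_simps)

text \<open>
  The mean value theorem in the direction \<open>u\<close> turns the second difference into a difference of
  gradients at two points whose displacement is exactly \<open>s v\<close>. Both points are within \<open>O(s)\<close> of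
  \<open>x\<close>, so differentiability of the gradient at the single point \<open>x\<close> suffices.
\<close>

lemma second_difference_approx:
  fixes f :: "'a::real_inner \<Rightarrow> real"
  assumes grad: "\<And>y. GDERIV f y :> grad y"
    and hess: "(grad has_derivative L) (at x)" and e: "e > 0"
  shows "\<exists>r>0. \<forall>s. 0 < s \<and> s < r \<longrightarrow>
    \<bar>second_difference f x (s *\<^sub>R u) (s *\<^sub>R v) - s\<^sup>2 * (u \<bullet> L v)\<bar> \<le> e * s\<^sup>2"
proof -
  define m where "m = norm u + norm v + 1"
  have m: "0 < m" unfolding m_def by (smt (verit) norm_ge_zero)
  interpret L: bounded_linear L using hess by (rule has_derivative_bounded_linear)
  obtain r where r: "r > 0" "\<And>k. norm k < r \<Longrightarrow> norm (grad (x + k) - grad x - L k) \<le> e / (2 * m\<^sup>2) * norm k"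
    using has_derivative_remainder_bound[OF hess, of "e / (2 * m\<^sup>2)"] e m by auto
  have "\<bar>second_difference f x (s *\<^sub>R u) (s *\<^sub>R v) - s\<^sup>2 * (u \<bullet> L v)\<bar> \<le> e * s\<^sup>2"
    if s: "0 < s" "s < r / m" for s
  proof -
    define \<psi> where "\<psi> a = f ((x + s *\<^sub>R v) + a *\<^sub>R (s *\<^sub>R u)) - f (x + a *\<^sub>R (s *\<^sub>R u))" for a
    have "\<exists>z>0. z < 1 \<and> \<psi> 1 - \<psi> 0 = (1 - 0) *
      (grad ((x + s *\<^sub>R v) + z *\<^sub>R (s *\<^sub>R u)) \<bullet> (s *\<^sub>R u) - grad (x + z *\<^sub>R (s *\<^sub>R u)) \<bullet> (s *\<^sub>R u))"
      unfolding \<psi>_def by (rule MVT2[OF zero_less_one], intro DERIV_diff GDERIV_line, rule grad, rule grad)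
    then obtain z where z: "0 < z" "z < 1" and mv: "\<psi> 1 - \<psi> 0 =
      (grad ((x + s *\<^sub>R v) + z *\<^sub>R (s *\<^sub>R u)) - grad (x + z *\<^sub>R (s *\<^sub>R u))) \<bullet> (s *\<^sub>R u)"
      unfolding inner_diff_left by auto
    have diff: "second_difference f x (s *\<^sub>R u) (s *\<^sub>R v) = \<psi> 1 - \<psi> 0"
      by (simp add: second_difference_def \<psi>_def algebra_simps)
    define k1 where "k1 = s *\<^sub>R v + z *\<^sub>R (s *\<^sub>R u)"
    define k2 where "k2 = z *\<^sub>R (s *\<^sub>R u)"
    have zu: "z * (s * norm u) \<le> s * norm u"
      using z s by (intro mult_left_le_one_le) auto
    have k2: "norm k2 \<le> s * m"
    proof -
      have "norm k2 = z * (s * norm u)" unfolding k2_def using z s by simp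
      moreover have "s * norm u \<le> s * m" using s by (intro mult_left_mono) (auto simp: m_def)
      ultimately show ?thesis using zu by linarith
    qed
    have k1: "norm k1 \<le> s * m"
    proof -
      have "norm k1 \<le> s * norm v + z * (s * norm u)"
        unfolding k1_def using norm_triangle_ineq[of "s *\<^sub>R v" "z *\<^sub>R (s *\<^sub>R u)"] z s by simp
      also have "\<dots> \<le> s * norm v + s * norm u" using zu by simp
      also have "\<dots> = s * (norm u + norm v)" by (simp add: algebra_simps)
      also have "\<dots> \<le> s * m" using s by (intro mult_left_mono) (auto simp: m_def)
      finally show ?thesis .
    qed
    have sm: "s * m < r" using s m by (simp add: field_simps)
    define E where "E k = grad (x + k) - grad x - L k" for k
    have E: "norm (E k) \<le> e / (2 * m\<^sup>2) * (s * m)" if "norm k \<le> s * m" for k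
    proof -
      have "norm (E k) \<le> e / (2 * m\<^sup>2) * norm k" unfolding E_def using r that sm by simp
      also have "\<dots> \<le> e / (2 * m\<^sup>2) * (s * m)" using that e by (intro mult_left_mono) auto
      finally show ?thesis .
    qed
    have "norm (E k1 - E k2) \<le> e / m * s"
    proof -
      have "norm (E k1 - E k2) \<le> 2 * (e / (2 * m\<^sup>2) * (s * m))"
        using norm_triangle_ineq4[of "E k1" "E k2"] E[OF k1] E[OF k2] by linarith
      also have "\<dots> = e / m * s" using m by (simp add: power2_eq_square)
      finally show ?thesis .
    qed
    have Lk: "L k1 - L k2 = s *\<^sub>R L v" by (simp add: k1_def k2_def L.add L.scaleR)
    have "\<psi> 1 - \<psi> 0 = (E k1 - E k2 + (L k1 - L k2)) \<bullet> (s *\<^sub>R u)"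
      unfolding mv E_def k1_def k2_def by (simp add: algebra_simps)
    then have "second_difference f x (s *\<^sub>R u) (s *\<^sub>R v) - s\<^sup>2 * (u \<bullet> L v) = (E k1 - E k2) \<bullet> (s *\<^sub>R u)"
      unfolding diff Lk by (simp add: inner_add_left inner_commute power2_eq_square algebra_simps)
    also have "\<bar>\<dots>\<bar> \<le> norm (E k1 - E k2) * norm (s *\<^sub>R u)" by (rule Cauchy_Schwarz_ineq2)
    also have "\<dots> \<le> (e / m * s) * (s * m)"
      using \<open>norm (E k1 - E k2) \<le> e / m * s\<close> s e m
      by (intro mult_mono) (auto simp: m_def)
    also have "\<dots> = e * s\<^sup>2" using m by (simp add: power2_eq_square)
    finally show ?thesis .
  qed
  then show ?thesis using r m by (intro exI[of _ "r / m"]) auto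
qed

text \<open>
  Both mixed second derivatives are the limit of the same second difference divided by \<open>s\<^sup>2\<close>.
\<close>

lemma second_derivative_symmetric:
  fixes f :: "'a::real_inner \<Rightarrow> real"
  assumes grad: "\<And>y. GDERIV f y :> grad y" and hess: "(grad has_derivative L) (at x)"
  shows "u \<bullet> L v = v \<bullet> L u"
proof (rule ccontr)
  assume ne: "u \<bullet> L v \<noteq> v \<bullet> L u"
  define e where "e = \<bar>u \<bullet> L v - v \<bullet> L u\<bar> / 3"
  have e: "e > 0" using ne by (simp add: e_def)
  obtain r1 where r1: "r1 > 0" "\<And>s. 0 < s \<Longrightarrow> s < r1 \<Longrightarrow>
    \<bar>second_difference f x (s *\<^sub>R u) (s *\<^sub>R v) - s\<^sup>2 * (u \<bullet> L v)\<bar> \<le> e * s\<^sup>2"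
    using second_difference_approx[OF grad hess e, of u v] by blast
  obtain r2 where r2: "r2 > 0" "\<And>s. 0 < s \<Longrightarrow> s < r2 \<Longrightarrow>
    \<bar>second_difference f x (s *\<^sub>R v) (s *\<^sub>R u) - s\<^sup>2 * (v \<bullet> L u)\<bar> \<le> e * s\<^sup>2"
    using second_difference_approx[OF grad hess e, of v u] by blast
  define s where "s = min r1 r2 / 2"
  have s: "0 < s" "s < r1" "s < r2" using r1 r2 by (auto simp: s_def)
  have "\<bar>s\<^sup>2 * (u \<bullet> L v) - s\<^sup>2 * (v \<bullet> L u)\<bar> \<le> 2 * (e * s\<^sup>2)"
    using r1(2)[OF s(1,2)] r2(2)[OF s(1,3)] second_difference_commute[of f x "s *\<^sub>R u" "s *\<^sub>R v"]
    by linarith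
  moreover have "s\<^sup>2 * (u \<bullet> L v) - s\<^sup>2 * (v \<bullet> L u) = s\<^sup>2 * (u \<bullet> L v - v \<bullet> L u)"
    by (simp add: algebra_simps)
  ultimately have "s\<^sup>2 * \<bar>u \<bullet> L v - v \<bullet> L u\<bar> \<le> s\<^sup>2 * (2 * e)"
    by (simp add: abs_mult mult.commute mult.left_commute)
  then show False using s e by (simp add: e_def)
qed

lemma hessian_symmetric:
  fixes f :: "real ^ 'n \<Rightarrow> real"
  assumes "\<And>y. GDERIV f y :> grad y" and "(grad has_derivative (\<lambda>h. H *v h)) (at x)"
  shows "transpose H = H"
proof -
  have "(transpose H *v u) \<bullet> v = (H *v u) \<bullet> v" for u v
    using second_derivative_symmetric[OF assms, of u v] by (simp add: dot_lmul_matrix inner_commute[of "H *v u"])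
  then show ?thesis by (metis vector_eq_rdot matrix_eq)
qed

section \<open>Searching for the multiplier\<close>

text \<open>
  Any solution serves. Where the multiplier is positive, \<open>t\<^sup>2\<close> is the same for all solutions;
  where it is 0, every choice yields a subgradient.
\<close>

definition hom_slope :: "real ^ 'n ^ 'n \<Rightarrow> real ^ 'n \<Rightarrow> real \<Rightarrow> real" where
  "hom_slope H g \<delta> = - (SOME t. \<exists>v. hom_solution H g \<delta> v t)\<^sup>2"

lemma hom_slope_solution:
  obtains v t where "hom_solution H g \<delta> v t" and "hom_slope H g \<delta> = - t\<^sup>2"
proof -
  have "\<exists>v. hom_solution H g \<delta> v (SOME t. \<exists>v. hom_solution H g \<delta> v t)"
    by (rule someI_ex) (use hom_solution_exists in blast)
  then show ?thesis using that unfolding hom_slope_def by blast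
qed

text \<open>
  A solution at \<open>\<delta>\<close> is feasible for the model at \<open>\<delta>'\<close>, where its value has changed by
  \<open>t\<^sup>2 * (\<delta>' - \<delta>)\<close>: this is the subgradient inequality.
\<close>

lemma hom_multiplier_search:
  fixes H :: "real ^ 'n ^ 'n"
  assumes psd: "psd H" and d: "0 < hom_multiplier H g d"
  shows "convex_search (hom_multiplier H g) (hom_slope H g) (norm g) d"
proof -
  have sym: "transpose H = H" using psd by (simp add: psd_def)
  have subgradient: "hom_multiplier H g \<delta> + hom_slope H g \<delta> * (\<delta>' - \<delta>) \<le> hom_multiplier H g \<delta>'"
    and bounds: "- 1 \<le> hom_slope H g \<delta>" "hom_slope H g \<delta> \<le> 0"
    and neg: "0 < hom_multiplier H g \<delta> \<Longrightarrow> hom_slope H g \<delta> < 0" for \<delta> \<delta>'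
  proof -
    obtain v t where sol: "hom_solution H g \<delta> v t" and D: "hom_slope H g \<delta> = - t\<^sup>2"
      by (rule hom_slope_solution)
    have norm: "norm (stack v t) \<le> 1" using sol by (simp add: hom_solution_def is_arg_min_def)
    show "hom_multiplier H g \<delta> + hom_slope H g \<delta> * (\<delta>' - \<delta>) \<le> hom_multiplier H g \<delta>'"
      using hom_multiplier_ge[OF sym norm, of g \<delta>'] hom_multiplier_eq(1)[OF sym sol]
        hom_form_slope[of v t H g \<delta>' \<delta>] by (simp add: D)
    have "(norm (stack v t))\<^sup>2 \<le> 1" using norm by (simp add: power_le_one)
    then have "t\<^sup>2 \<le> 1" using zero_le_power2[of "norm v"] unfolding norm_stack by linarith
    then show "- 1 \<le> hom_slope H g \<delta>" by (simp add: D)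
    show "hom_slope H g \<delta> \<le> 0" by (simp add: D)
    show "hom_slope H g \<delta> < 0" if "0 < hom_multiplier H g \<delta>"
      using hom_solution_positive_multiplier(1)[OF psd sol that] by (simp add: D)
  qed
  have slope_lip: "\<bar>hom_slope H g \<delta> - hom_slope H g \<delta>'\<bar> \<le> norm g / b\<^sup>2 * \<bar>hom_multiplier H g \<delta> - hom_multiplier H g \<delta>'\<bar>"
    if b: "0 < b" "b \<le> hom_multiplier H g \<delta>" "b \<le> hom_multiplier H g \<delta>'" for b \<delta> \<delta>'
  proof -
    obtain v t where sol: "hom_solution H g \<delta> v t" and D: "hom_slope H g \<delta> = - t\<^sup>2"
      by (rule hom_slope_solution)
    obtain v' t' where sol': "hom_solution H g \<delta>' v' t'" and D': "hom_slope H g \<delta>' = - t'\<^sup>2"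
      by (rule hom_slope_solution)
    have "\<bar>t\<^sup>2 - t'\<^sup>2\<bar> \<le> norm g / b\<^sup>2 * \<bar>hom_multiplier H g \<delta> - hom_multiplier H g \<delta>'\<bar>"
      by (rule hom_slope_lipschitz[OF psd b(1) sol sol' b(2,3)])
    then show ?thesis by (simp add: D D' abs_minus_commute)
  qed
  show ?thesis by unfold_locales (use subgradient bounds neg slope_lip d in auto)
qed

lemma hom_solution_newton_direction:
  fixes H :: "real ^ 'n ^ 'n"
  assumes psd: "psd H" and sol: "hom_solution H g \<delta> v t"
    and c: "hom_multiplier H g \<delta> = c" "0 < c"
  shows "t \<noteq> 0" and "(1 / t) *\<^sub>R v = - (matrix_inv (H + c *\<^sub>R mat 1) *v g)"
proof -
  have pos: "0 < hom_multiplier H g \<delta>" using c by simp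
  show "t \<noteq> 0" by (rule hom_solution_positive_multiplier(1)[OF psd sol pos])
  have "(H + c *\<^sub>R mat 1) *v (- (1 / t) *\<^sub>R v) = g"
    unfolding shift_mult using hom_solution_positive_multiplier(2)[OF psd sol pos] c by simp
  then have "- (1 / t) *\<^sub>R v = matrix_inv (H + c *\<^sub>R mat 1) *v g"
    using matrix_inv_solution[OF psd_shift_invertible[OF psd c(2)]] by blast
  then show "(1 / t) *\<^sub>R v = - (matrix_inv (H + c *\<^sub>R mat 1) *v g)"
    by (metis minus_minus scaleR_minus_left)
qed

theorem theorem2p3:
  fixes f :: "real ^ 'n \<Rightarrow> real"
    and grad :: "real ^ 'n \<Rightarrow> real ^ 'n"
    and hess :: "real ^ 'n \<Rightarrow> real ^ 'n ^ 'n"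
    and x g :: "real ^ 'n"
    and H :: "real ^ 'n ^ 'n"
    and \<gamma> c :: real
    and \<theta> :: "real \<Rightarrow> real"
  assumes convex: "convex_on UNIV f"
    and grad: "\<And>y. GDERIV f y :> grad y"
    and hess: "\<And>y. (grad has_derivative (\<lambda>h. hess y *v h)) (at y)"
    and g: "g = grad x" and g_nz: "g \<noteq> 0"
    and H: "H = hess x"
    and gamma: "\<gamma> > 0"
    and c: "c = \<gamma> * norm g powr (1 / 2)"
    and theta: "\<theta> = hom_multiplier H g"
  shows "\<exists>\<delta>k.
     \<theta> \<delta>k = c \<and>
     invertible (H + c *\<^sub>R mat 1) \<and>
     (\<exists>v t. hom_solution H g \<delta>k v t) \<and>
     (\<forall>v t. hom_solution H g \<delta>k v t \<longrightarrow>
        t \<noteq> 0 \<and> x + (1 / t) *\<^sub>R v = x - matrix_inv (H + c *\<^sub>R mat 1) *v g) \<and>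
     (\<exists>l u. brackets \<theta> c l u) \<and>
     (\<forall>l u. brackets \<theta> c l u \<longrightarrow>
        (\<forall>\<epsilon>>0. \<forall>\<^sub>F j in sequentially. accurate \<theta> \<delta>k \<epsilon> (bisection_iterates \<theta> c l u j)) \<and>
        (\<lambda>\<epsilon>. real (inner_iterations \<theta> \<delta>k (bisection_iterates \<theta> c l u) \<epsilon>))
          \<in> O[at_right 0](\<lambda>\<epsilon>. ln (1 / \<epsilon>))) \<and>
     (\<forall>\<delta>0. \<theta> \<delta>0 > 0 \<longrightarrow>
        (\<exists>\<delta>s. \<delta>s 0 = \<delta>0 \<and> newton_iterates \<theta> c \<delta>s \<and>
           (\<forall>\<epsilon>>0. \<forall>\<^sub>F j in sequentially. accurate \<theta> \<delta>k \<epsilon> (\<delta>s j)) \<and>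
           (\<lambda>\<epsilon>. real (inner_iterations \<theta> \<delta>k \<delta>s \<epsilon>))
             \<in> O[at_right 0](\<lambda>\<epsilon>. ln (ln (1 / \<epsilon>)))))"
proof -
  have c_pos: "0 < c" using gamma g_nz by (simp add: c)
  have psd: "psd H"
    unfolding psd_def H using hessian_symmetric[OF grad hess] hessian_psd[OF convex grad hess] by blast
  obtain d where d: "\<theta> d = c" using hom_multiplier_attained[OF psd c_pos, of g] theta by blast
  interpret convex_search \<theta> "hom_slope H g" "norm g" d
    unfolding theta using d theta c_pos by (intro hom_multiplier_search[OF psd]) simp
  show ?thesis
  proof (rule exI[of _ d], intro conjI allI impI)
    show "\<theta> d = c" by (rule d)
    show "invertible (H + c *\<^sub>R mat 1)" by (rule psd_shift_invertible[OF psd c_pos])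
    show "\<exists>v t. hom_solution H g d v t" by (rule hom_solution_exists)
  next
    fix v t assume "hom_solution H g d v t"
    note newton = hom_solution_newton_direction[OF psd this d[unfolded theta] c_pos]
    show "t \<noteq> 0" by (rule newton)
    show "x + (1 / t) *\<^sub>R v = x - matrix_inv (H + c *\<^sub>R mat 1) *v g" unfolding newton(2) by simp
  next
    show "\<exists>l u. brackets \<theta> c l u"
      using brackets_iff[of "d - 1" "d + 1"] unfolding d by (intro exI[of _ "d - 1"] exI[of _ "d + 1"]) simp
  next
    fix l u and \<epsilon> :: real assume "brackets \<theta> c l u" "\<epsilon> > 0"
    then show "\<forall>\<^sub>F j in sequentially. accurate \<theta> d \<epsilon> (bisection_iterates \<theta> c l u j)"
      using bisection_converges unfolding d by blast
  next
    fix l u assume "brackets \<theta> c l u"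
    then show "(\<lambda>\<epsilon>. real (inner_iterations \<theta> d (bisection_iterates \<theta> c l u) \<epsilon>))
        \<in> O[at_right 0](\<lambda>\<epsilon>. ln (1 / \<epsilon>))"
      using bisection_iterations unfolding d by blast
  next
    fix \<delta>0 assume pos: "0 < \<theta> \<delta>0"
    show "\<exists>\<delta>s. \<delta>s 0 = \<delta>0 \<and> newton_iterates \<theta> c \<delta>s \<and>
           (\<forall>\<epsilon>>0. \<forall>\<^sub>F j in sequentially. accurate \<theta> d \<epsilon> (\<delta>s j)) \<and>
           (\<lambda>\<epsilon>. real (inner_iterations \<theta> d \<delta>s \<epsilon>)) \<in> O[at_right 0](\<lambda>\<epsilon>. ln (ln (1 / \<epsilon>)))"
      using newton_iterates_funpow(1)[OF pos] newton_converges[OF pos] newton_iterations[OF pos]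
      unfolding d by (intro exI[of _ "\<lambda>j. (newton_step ^^ j) \<delta>0"]) auto
  qed
qed

end
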